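(* For all integers $n\geq 8$, $p_{\mathrm{od}}^{\mathrm{ed}}(n)< p_{\mathrm{eu}}^{\mathrm{od}}(n)$.
   Context: A partition of a non-negative integer $n$ is a non-increasing (finite, possibly empty) sequence of positive integers, called parts, summing to $n$. $p_{\mathrm{od}}^{\mathrm{ed}}(n)$ is the number of partitions of $n$ in which every even part is larger than every odd part, the even parts are pairwise distinct, and the odd parts are pairwise distinct. $p_{\mathrm{eu}}^{\mathrm{od}}(n)$ is the number of partitions of $n$ in which every odd part is larger than every even part, the odd parts are pairwise distinct, and the even parts are unrestricted (may be repeated). In both cases partitions with no even parts or with no odd parts are allowed. *)

theory Defs
  imports Main
begin

definition partitions :: "nat \<Rightarrow> nat list set" where
  "partitions n =
     {xs. sorted_wrt (\<ge>) xs \<and> (\<forall>x\<in>set xs. 0 < x) \<and> sum_list xs = n}"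

text \<open>
  In the names below, the superscript of the paper's notation comes first: it gives the parity
  of the larger parts (\<open>e\<close> or \<open>o\<close>), followed by \<open>d\<close> for distinct or \<open>u\<close> for unrestricted;
  the subscript does the same for the smaller parts.
  The order conditions hold vacuously when there are no even or no odd parts.
\<close>

definition partitions_ed_od :: "nat \<Rightarrow> nat list set" where
  "partitions_ed_od n =
     {xs \<in> partitions n.
        (\<forall>x\<in>set xs. \<forall>y\<in>set xs. even x \<longrightarrow> odd y \<longrightarrow> y < x) \<and>
        distinct (filter even xs) \<and> distinct (filter odd xs)}"

definition partitions_od_eu :: "nat \<Rightarrow> nat list set" where
  "partitions_od_eu n =
     {xs \<in> partitions n.
        (\<forall>x\<in>set xs. \<forall>y\<in>set xs. odd x \<longrightarrow> even y \<longrightarrow> y < x) \<and>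
        distinct (filter odd xs)}"

definition p_ed_od :: "nat \<Rightarrow> nat" where
  "p_ed_od n = card (partitions_ed_od n)"

definition p_od_eu :: "nat \<Rightarrow> nat" where
  "p_od_eu n = card (partitions_od_eu n)"

text \<open>The sets being counted are finite, so \<open>card\<close> is the actual number of elements.\<close>

lemma finite_partitions: "finite (partitions n)"
proof (rule finite_subset)
  have "length xs \<le> sum_list xs" if "\<forall>x\<in>set xs. 0 < x" for xs :: "nat list"
    using that by (induction xs) auto
  then show "partitions n \<subseteq> {xs. set xs \<subseteq> {..n} \<and> length xs \<le> n}"
    by (auto simp: partitions_def intro: member_le_sum_list)
  show "finite {xs. set xs \<subseteq> {..n} \<and> length xs \<le> n}"
    by (rule finite_lists_length_le) simp
qed

lemma finite_partitions_ed_od: "finite (partitions_ed_od n)"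
  and finite_partitions_od_eu: "finite (partitions_od_eu n)"
  by (simp_all add: partitions_ed_od_def partitions_od_eu_def finite_partitions)

end

theory Submission
  imports Defs
begin

text \<open>
  Fix the number \<open>j\<close> of odd parts and the number \<open>k\<close> of even parts. On either side of the
  inequality, subtracting the smallest admissible partition and halving leaves an arbitrary
  partition into at most \<open>j + k\<close> parts, so the two classes are counted by the same function
  at different arguments. If \<open>j > 0\<close> and \<open>k > 0\<close>, the smallest sums are \<open>(j + k)\<^sup>2 - k\<close> and
  \<open>j\<^sup>2 + 2 j + 2 k\<close>, and the first is at least the second unless \<open>k = 1\<close>. The deficit of the class
  \<open>(j, 1)\<close> with \<open>j \<ge> 2\<close> is covered by the surplus of \<open>(j - 2, 3)\<close>; that of \<open>(1, 1)\<close> is at most one.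
  Strictness comes from \<open>(0, 4)\<close> for even \<open>n\<close> and from \<open>(1, 4)\<close> and \<open>(1, 5)\<close> for odd \<open>n \<ge> 13\<close>,
  while \<open>n = 9\<close> and \<open>n = 11\<close> use \<open>(1, 3)\<close>.
\<close>

section \<open>Partitions with a bounded number of parts\<close>

text \<open>
  Entries may be 0, so these are the partitions into at most \<open>m\<close> parts. Prescribing the double of
  the sum as an integer makes the set empty for odd or negative \<open>z\<close>.
\<close>

definition bounded_partitions :: "nat \<Rightarrow> int \<Rightarrow> nat list set" where
  "bounded_partitions m z =
     {xs. length xs = m \<and> sorted_wrt (\<ge>) xs \<and> 2 * int (sum_list xs) = z}"

definition num_bounded :: "nat \<Rightarrow> int \<Rightarrow> int" where
  "num_bounded m z = int (card (bounded_partitions m z))"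

text \<open>This counts what \<open>num_bounded m\<close> gains when its argument grows by 2, see
  \<open>num_bounded_step\<close>. The indices 0 and 1 are meaningful only for
  \<open>m \<ge> 2\<close>.\<close>

definition num_tied :: "nat \<Rightarrow> int \<Rightarrow> int" where
  "num_tied m z = int (card {xs \<in> bounded_partitions m z. xs ! 0 = xs ! 1})"

lemma finite_bounded_partitions: "finite (bounded_partitions m z)"
proof (rule finite_subset)
  show "bounded_partitions m z \<subseteq> {xs. set xs \<subseteq> {..nat z} \<and> length xs = m}"
    by (force simp: bounded_partitions_def dest: member_le_sum_list)
  show "finite {xs. set xs \<subseteq> {..nat z} \<and> length xs = m}"
    by (rule finite_lists_length_eq) simp
qed

lemma num_bounded_neg: "z < 0 \<Longrightarrow> num_bounded m z = 0"
  by (auto simp: num_bounded_def bounded_partitions_def card_eq_0_iff)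

lemma num_tied_nonneg: "num_tied m z \<ge> 0"
  by (simp add: num_tied_def)

lemma bounded_partitions_ge2:
  assumes "xs \<in> bounded_partitions m z" "m \<ge> 2"
  shows "\<exists>x y ys. xs = x # y # ys"
proof -
  have "length xs = Suc (Suc (m - 2))"
    using assms by (simp add: bounded_partitions_def)
  then show ?thesis
    by (auto simp: length_Suc_conv)
qed

text \<open>Lists whose first entry exceeds the second arise by raising the first entry by one.\<close>

lemma num_bounded_step:
  assumes "m \<ge> 2"
  shows "num_bounded m z = num_bounded m (z - 2) + num_tied m z"
proof -
  define bump :: "nat list \<Rightarrow> nat list" where "bump = (\<lambda>xs. Suc (hd xs) # tl xs)"
  have len: "\<exists>x y ys. xs = x # y # ys" if "xs \<in> bounded_partitions m w" for xs w
    using bounded_partitions_ge2[OF that assms] .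
  have inj: "inj_on bump (bounded_partitions m (z - 2))"
  proof (rule inj_onI)
    fix xs ys assume "xs \<in> bounded_partitions m (z - 2)" "ys \<in> bounded_partitions m (z - 2)"
      "bump xs = bump ys"
    then show "xs = ys"
      using len[of xs "z - 2"] len[of ys "z - 2"] by (auto simp: bump_def)
  qed
  have split: "bounded_partitions m z =
      bump ` bounded_partitions m (z - 2) \<union> {xs \<in> bounded_partitions m z. xs ! 0 = xs ! 1}"
    (is "?L = ?B \<union> ?E")
  proof
    show "?L \<subseteq> ?B \<union> ?E"
    proof
      fix xs assume xs: "xs \<in> ?L"
      obtain x y ys where [simp]: "xs = x # y # ys"
        using len[OF xs] by blast
      show "xs \<in> ?B \<union> ?E"
      proof (cases "x = y")
        case False
        with xs have "(x - 1) # y # ys \<in> bounded_partitions m (z - 2)" "xs = bump ((x - 1) # y # ys)"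
          by (auto simp: bounded_partitions_def bump_def)
        then have "xs \<in> ?B"
          by (metis imageI)
        then show ?thesis by (rule UnI1)
      qed (use xs in auto)
    qed
    show "?B \<union> ?E \<subseteq> ?L"
    proof -
      have "bump xs \<in> ?L" if xs: "xs \<in> bounded_partitions m (z - 2)" for xs
      proof -
        obtain x y ys where [simp]: "xs = x # y # ys"
          using len[OF xs] by blast
        show ?thesis
          using xs by (auto simp: bounded_partitions_def bump_def)
      qed
      then show ?thesis by auto
    qed
  qed
  have disj: "bump ` bounded_partitions m (z - 2) \<inter>
      {xs \<in> bounded_partitions m z. xs ! 0 = xs ! 1} = {}"
  proof -
    have "bump xs ! 0 \<noteq> bump xs ! 1" if xs: "xs \<in> bounded_partitions m (z - 2)" for xs
    proof -
      obtain x y ys where [simp]: "xs = x # y # ys"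
        using len[OF xs] by blast
      show ?thesis
        using xs by (auto simp: bounded_partitions_def bump_def)
    qed
    then show ?thesis by auto
  qed
  have "card (bounded_partitions m z) = card (bump ` bounded_partitions m (z - 2)) +
      card {xs \<in> bounded_partitions m z. xs ! 0 = xs ! 1}"
    by (subst split, rule card_Un_disjoint) (use disj in \<open>auto simp: finite_bounded_partitions\<close>)
  then show ?thesis
    by (simp add: num_bounded_def num_tied_def card_image[OF inj])
qed

text \<open>Raising the first two entries by one keeps them equal and adds 4 to the doubled
  sum.\<close>

lemma num_tied_step:
  assumes "m \<ge> 2"
  shows "num_tied m z \<le> num_tied m (z + 4)"
proof -
  define bump :: "nat list \<Rightarrow> nat list"
    where "bump = (\<lambda>xs. Suc (xs ! 0) # Suc (xs ! 1) # drop 2 xs)"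
  let ?E = "\<lambda>z. {xs \<in> bounded_partitions m z. xs ! 0 = xs ! 1}"
  have len: "\<exists>x y ys. xs = x # y # ys" if "xs \<in> ?E z" for xs
    using that assms bounded_partitions_ge2 by blast
  have "inj_on bump (?E z)"
  proof (rule inj_onI)
    fix xs ys assume "xs \<in> ?E z" "ys \<in> ?E z" "bump xs = bump ys"
    then show "xs = ys"
      using len[of xs] len[of ys] by (auto simp: bump_def)
  qed
  moreover have "bump ` ?E z \<subseteq> ?E (z + 4)"
  proof
    fix ys assume "ys \<in> bump ` ?E z"
    then obtain xs where "xs \<in> ?E z" "ys = bump xs" by blast
    then show "ys \<in> ?E (z + 4)"
      using len[of xs] by (fastforce simp: bump_def bounded_partitions_def)
  qed
  ultimately show ?thesis
    unfolding num_tied_def by (simp add: card_inj_on_le finite_bounded_partitions)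
qed

lemma num_tied_mono:
  assumes "m \<ge> 2" "z \<le> w" "4 dvd w - z"
  shows "num_tied m z \<le> num_tied m w"
proof -
  have "num_tied m z \<le> num_tied m (z + 4 * int t)" for t
  proof (induction t)
    case (Suc t)
    then show ?case
      using num_tied_step[OF assms(1), of "z + 4 * int t"] by (simp add: algebra_simps)
  qed simp
  from this[of "nat ((w - z) div 4)"] show ?thesis
    using assms by (simp add: pos_imp_zdiv_nonneg_iff)
qed

text \<open>Both entries of a tied pair must equal \<open>z / 4\<close>.\<close>

lemma num_tied_two_le: "num_tied 2 z \<le> 1"
proof -
  have "{xs \<in> bounded_partitions 2 z. xs ! 0 = xs ! 1} \<subseteq> {[nat (z div 4), nat (z div 4)]}"
    by (auto simp: bounded_partitions_def length_Suc_conv numeral_2_eq_2)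
  from card_mono[OF _ this] show ?thesis
    by (simp add: num_tied_def)
qed

lemma num_tied_two_eq_0: "\<not> 4 dvd z \<Longrightarrow> num_tied 2 z = 0"
  by (auto simp: num_tied_def card_eq_0_iff bounded_partitions_def length_Suc_conv numeral_2_eq_2)

text \<open>Half of the difference \<open>w - z\<close> is added to the first entry, which is
  injective and keeps the order.\<close>

lemma num_bounded_mono:
  assumes "m \<ge> 1" "z \<le> w" "even (w - z)"
  shows "num_bounded m z \<le> num_bounded m w"
proof -
  define t where "t = nat ((w - z) div 2)"
  have w: "w = z + 2 * int t"
    using assms by (auto simp: t_def)
  define bump :: "nat list \<Rightarrow> nat list" where "bump = (\<lambda>xs. (hd xs + t) # tl xs)"
  have len: "\<exists>x xs'. xs = x # xs'" if "xs \<in> bounded_partitions m z" for xs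
    using that assms(1) by (cases xs) (auto simp: bounded_partitions_def)
  have "inj_on bump (bounded_partitions m z)"
  proof (rule inj_onI)
    fix xs ys assume "xs \<in> bounded_partitions m z" "ys \<in> bounded_partitions m z" "bump xs = bump ys"
    then show "xs = ys"
      using len[of xs] len[of ys] by (auto simp: bump_def)
  qed
  moreover have "bump ` bounded_partitions m z \<subseteq> bounded_partitions m w"
  proof
    fix ys assume "ys \<in> bump ` bounded_partitions m z"
    then obtain xs where "xs \<in> bounded_partitions m z" "ys = bump xs" by blast
    then show "ys \<in> bounded_partitions m w"
      using len[of xs] by (fastforce simp: bump_def bounded_partitions_def w)
  qed
  ultimately show ?thesis
    unfolding num_bounded_def by (simp add: card_inj_on_le finite_bounded_partitions)
qed

lemma num_tied_zero_pos: "num_tied m 0 \<ge> 1" if "m \<ge> 2"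
proof -
  have "replicate m 0 \<in> {xs \<in> bounded_partitions m 0. xs ! 0 = xs ! 1}"
    using that by (auto simp: bounded_partitions_def sorted_wrt_iff_nth_less sum_list_replicate)
  then have "card {xs \<in> bounded_partitions m 0. xs ! 0 = xs ! 1} \<noteq> 0"
    by (auto simp: card_eq_0_iff finite_bounded_partitions)
  then show ?thesis
    by (simp add: num_tied_def)
qed

text \<open>Growing from \<open>w - 4\<close> to \<open>w\<close> gains the tied lists at
  \<open>w\<close> and at \<open>w - 2\<close>. One of these two arguments is a nonnegative multiple
  of 4, so it inherits a tied list from the zero list at argument 0.\<close>

lemma num_bounded_less:
  assumes "m \<ge> 2" "w \<ge> 0" "even w" "z + 4 \<le> w" "even z"
  shows "num_bounded m z < num_bounded m w"
proof -
  have "num_bounded m z \<le> num_bounded m (w - 4)"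
    using assms by (intro num_bounded_mono) auto
  moreover have "num_bounded m w = num_bounded m (w - 4) + num_tied m w + num_tied m (w - 2)"
    using num_bounded_step[OF assms(1), of w] num_bounded_step[OF assms(1), of "w - 2"] by simp
  moreover have "num_tied m w \<ge> 1 \<or> num_tied m (w - 2) \<ge> 1"
  proof (cases "4 dvd w")
    case True
    then show ?thesis
      using num_tied_mono[of m 0 w] num_tied_zero_pos[of m] assms by auto
  next
    case False
    then have "4 dvd w - 2" "w - 2 \<ge> 0"
      using assms by presburger+
    then show ?thesis
      using num_tied_mono[of m 0 "w - 2"] num_tied_zero_pos[of m] assms by auto
  qed
  ultimately show ?thesis
    using num_tied_nonneg[of m w] num_tied_nonneg[of m "w - 2"] by linarith
qed

section \<open>Partitions with prescribed numbers of odd and even parts\<close>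

definition class_ed_od :: "nat \<Rightarrow> nat \<Rightarrow> nat \<Rightarrow> nat list set" where
  "class_ed_od n j k =
     {xs \<in> partitions_ed_od n. length (filter odd xs) = j \<and> length (filter even xs) = k}"

definition class_od_eu :: "nat \<Rightarrow> nat \<Rightarrow> nat \<Rightarrow> nat list set" where
  "class_od_eu n j k =
     {xs \<in> partitions_od_eu n. length (filter odd xs) = j \<and> length (filter even xs) = k}"

lemma length_le_sum_list: "\<forall>x\<in>set xs. 0 < x \<Longrightarrow> length xs \<le> sum_list (xs :: nat list)"
  by (induction xs) auto

text \<open>All parts are positive, so neither parity can have more than \<open>n\<close> of them
  and the finite ranges lose nothing.\<close>

lemma card_parity_classes:
  assumes "S \<subseteq> partitions n" "finite S"
  shows "card S = (\<Sum>j\<le>n. \<Sum>k\<le>n.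
    card {xs \<in> S. length (filter odd xs) = j \<and> length (filter even xs) = k})"
proof -
  let ?c = "\<lambda>xs :: nat list. (length (filter odd xs), length (filter even xs))"
  have "?c xs \<in> {..n} \<times> {..n}" if "xs \<in> S" for xs
  proof -
    have "xs \<in> partitions n"
      using that assms by blast
    then have "length xs \<le> n"
      using length_le_sum_list[of xs] by (simp add: partitions_def)
    then show ?thesis
      using length_filter_le[of odd xs] length_filter_le[of even xs] by (auto intro: order_trans simp del: length_filter_le)
  qed
  then have "S = (\<Union>p\<in>{..n} \<times> {..n}. {xs \<in> S. ?c xs = p})"
    by auto
  then have "card S = card (\<Union>p\<in>{..n} \<times> {..n}. {xs \<in> S. ?c xs = p})"
    by simp
  also have "\<dots> = (\<Sum>p\<in>{..n} \<times> {..n}. card {xs \<in> S. ?c xs = p})"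
    by (rule card_UN_disjoint) (use assms in auto)
  also have "\<dots> = (\<Sum>j\<le>n. \<Sum>k\<le>n. card {xs \<in> S. ?c xs = (j, k)})"
    by (subst sum.cartesian_product) (rule sum.cong, auto)
  finally show ?thesis by simp
qed

lemma p_ed_od_eq_sum: "p_ed_od n = (\<Sum>j\<le>n. \<Sum>k\<le>n. card (class_ed_od n j k))"
  unfolding p_ed_od_def class_ed_od_def
  by (rule card_parity_classes) (auto simp: finite_partitions_ed_od, auto simp: partitions_ed_od_def)

lemma p_od_eu_eq_sum: "p_od_eu n = (\<Sum>j\<le>n. \<Sum>k\<le>n. card (class_od_eu n j k))"
  unfolding p_od_eu_def class_od_eu_def
  by (rule card_parity_classes) (auto simp: finite_partitions_od_eu, auto simp: partitions_od_eu_def)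

section \<open>Upper bound for the classes with the even parts on top\<close>

text \<open>No even entry can follow an odd one: it would have to be larger, against the order of
  the list.\<close>

lemma ed_od_append:
  assumes "sorted_wrt (\<ge>) xs" "\<forall>x\<in>set xs. \<forall>y\<in>set xs. even x \<longrightarrow> odd y \<longrightarrow> y < (x :: nat)"
  shows "xs = filter even xs @ filter odd xs"
  using assms
proof (induction xs)
  case (Cons x xs)
  show ?case
  proof (cases "even x")
    case False
    then have "\<forall>y\<in>set xs. odd y"
      using Cons.prems by fastforce
    then show ?thesis
      using False by (simp add: filter_id_conv filter_empty_conv)
  qed (use Cons in auto)
qed simp

lemma sum_staircase: "(\<Sum>i<m. 2 * (m - Suc i)) = m * (m - 1)" for m :: nat
proof -
  have "(\<Sum>i<m. 2 * (m - Suc i)) = (\<Sum>i<m. 2 * i)"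
    by (rule sum.nat_diff_reindex)
  also have "\<dots> = m * (m - 1)"
  proof (induction m)
    case (Suc m)
    then show ?case by (cases m) auto
  qed simp
  finally show ?thesis .
qed

lemma nth_append_parity:
  assumes "xs = filter even xs @ filter odd xs" "i < length xs"
  shows "even (xs ! i) \<longleftrightarrow> i < length (filter even xs)"
proof (cases "i < length (filter even xs)")
  case True
  then have "xs ! i = filter even xs ! i"
    by (subst assms(1)) (simp add: nth_append)
  moreover have "filter even xs ! i \<in> set (filter even xs)"
    using True by (rule nth_mem)
  ultimately show ?thesis
    using True by simp
next
  case False
  let ?i = "i - length (filter even xs)"
  have "length xs = length (filter even xs) + length (filter odd xs)"
    by (subst assms(1)) simp
  then have "?i < length (filter odd xs)"
    using assms(2) False by simp
  then have "filter odd xs ! ?i \<in> set (filter odd xs)"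
    by (rule nth_mem)
  moreover have "xs ! i = filter odd xs ! ?i"
    using False by (subst assms(1)) (simp add: nth_append)
  ultimately show ?thesis
    using False by simp
qed

lemma class_ed_od_D:
  assumes "xs \<in> class_ed_od n j k"
  shows "length xs = k + j" "sum_list xs = n"
    and "\<And>i. i < k + j \<Longrightarrow> 0 < xs ! i"
    and "\<And>i. i < k + j \<Longrightarrow> even (xs ! i) \<longleftrightarrow> i < k"
    and "\<And>i. Suc i < k + j \<Longrightarrow> xs ! Suc i < xs ! i"
proof -
  from assms have sorted: "sorted_wrt (\<ge>) xs" and pos: "\<forall>x\<in>set xs. 0 < x" and sum: "sum_list xs = n"
    and above: "\<forall>x\<in>set xs. \<forall>y\<in>set xs. even x \<longrightarrow> odd y \<longrightarrow> y < x"
    and dist: "distinct (filter even xs)" "distinct (filter odd xs)"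
    and len: "length (filter odd xs) = j" "length (filter even xs) = k"
    by (auto simp: class_ed_od_def partitions_ed_od_def partitions_def)
  note app = ed_od_append[OF sorted above]
  have "length xs = length (filter even xs) + length (filter odd xs)"
    by (subst app) simp
  then show length: "length xs = k + j"
    using len by simp
  have "distinct (filter even xs @ filter odd xs)"
    using dist by auto
  then have distinct: "distinct xs"
    using app by simp
  show "sum_list xs = n" by (fact sum)
  show "0 < xs ! i" if "i < k + j" for i
    using pos that length by simp
  show "even (xs ! i) \<longleftrightarrow> i < k" if "i < k + j" for i
    using nth_append_parity[OF app, of i] that length len by simp
  show "xs ! Suc i < xs ! i" if "Suc i < k + j" for i
  proof -
    have "xs ! Suc i \<le> xs ! i"
      using sorted that length by (simp add: sorted_wrt_iff_nth_less)
    moreover have "xs ! Suc i \<noteq> xs ! i"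
      using distinct that length by (simp add: nth_eq_iff_index_eq)
    ultimately show ?thesis by simp
  qed
qed

text \<open>
  The parts, in decreasing order, of the smallest partition in the class. For \<open>j > 0\<close> it is
  \<open>2 j + 2 k - 2, \<dots>, 2 j, 2 j - 1, \<dots>, 3, 1\<close>; for \<open>j = 0\<close> the even parts start at 2 instead of 0.
\<close>

definition min_ed_od :: "nat \<Rightarrow> nat \<Rightarrow> nat \<Rightarrow> nat" where
  "min_ed_od j k i =
     2 * (k + j - Suc i) + (if i < k then if j = 0 then 2 else 0 else 1)"

lemma sum_min_ed_od:
  "(\<Sum>i<k + j. min_ed_od j k i) = (k + j) * (k + j - 1) + (if j = 0 then 2 * k else j)"
proof -
  have "(\<Sum>i<k + j. if i < k then e else 1) = k * e + j" for e :: nat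
    by (induction j) auto
  then show ?thesis
    by (simp add: min_ed_od_def sum.distrib sum_staircase)
qed

text \<open>The excess over the smallest partition never increases along the list, so it suffices to
  bound it at the last entry.\<close>

lemma class_ed_od_ge_min:
  assumes "xs \<in> class_ed_od n j k" "i \<le> i'" "i' < k + j"
  shows "int (xs ! i') - int (min_ed_od j k i') \<le> int (xs ! i) - int (min_ed_od j k i)"
    and "0 \<le> int (xs ! i) - int (min_ed_od j k i)"
    and "even (int (xs ! i) - int (min_ed_od j k i))"
proof -
  note D = class_ed_od_D[OF assms(1)]
  let ?d = "\<lambda>i. int (xs ! i) - int (min_ed_od j k i)"
  show even: "even (?d i)"
    using D(4)[of i] assms by (auto simp: min_ed_od_def)
  have step: "?d (Suc i) \<le> ?d i" if i: "Suc i < k + j" for i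
  proof -
    have less: "xs ! Suc i < xs ! i"
      using D(5) i by simp
    \<comment> \<open>Inside a block of equal parity a strict descent is at least 2, as in
      \<open>min_ed_od\<close>; at the border from even to odd it is at least 1, and
      \<open>min_ed_od\<close> drops there by exactly 1.\<close>
    consider "Suc i < k" | "Suc i = k" "j > 0" | "k \<le> i"
      using i by linarith
    then show ?thesis
    proof cases
      case 2
      then show ?thesis
        using less by (auto simp: min_ed_od_def)
    qed (use less i D(4)[of i] D(4)[of "Suc i"] in \<open>auto simp: min_ed_od_def; presburger\<close>)+
  qed
  have anti: "?d b \<le> ?d a" if "a \<le> b" "b < k + j" for a b
    using that
  proof (induction rule: dec_induct)
    case (step b)
    with \<open>\<And>i. Suc i < k + j \<Longrightarrow> ?d (Suc i) \<le> ?d i\<close>[of b] show ?case by linarith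
  qed simp
  show "?d i' \<le> ?d i"
    using anti assms by blast
  \<comment> \<open>The last part is at least 1, and at least 2 if there are no odd parts.\<close>
  have "0 \<le> ?d (k + j - 1)"
    using D(3)[of "k + j - 1"] D(4)[of "k + j - 1"] assms
    by (cases "j = 0") (auto simp: min_ed_od_def Suc_le_eq elim!: evenE)
  then show "0 \<le> ?d i"
    using anti[of i "k + j - 1"] assms by force
qed

text \<open>An injection is enough, since this count enters the final difference with a minus
  sign.\<close>

lemma card_class_ed_od_le:
  "int (card (class_ed_od n j k)) \<le>
     num_bounded (k + j) (int n - int (\<Sum>i<k + j. min_ed_od j k i))"
proof -
  define f where "f = (\<lambda>xs. map (\<lambda>i. (xs ! i - min_ed_od j k i) div 2) [0..<k + j])"
  have nth: "xs ! i = min_ed_od j k i + 2 * (f xs ! i)" if "xs \<in> class_ed_od n j k" "i < k + j" for xs i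
    using class_ed_od_ge_min(2,3)[OF that(1) order_refl that(2)] that(2)
    by (simp add: f_def)
  have len: "length (f xs) = k + j" for xs
    by (simp add: f_def)
  have "inj_on f (class_ed_od n j k)"
  proof (rule inj_onI)
    fix xs ys assume "xs \<in> class_ed_od n j k" "ys \<in> class_ed_od n j k" "f xs = f ys"
    then show "xs = ys"
      using nth[of xs] nth[of ys] by (auto intro!: nth_equalityI simp: class_ed_od_D(1))
  qed
  moreover have "f ` class_ed_od n j k \<subseteq>
      bounded_partitions (k + j) (int n - int (\<Sum>i<k + j. min_ed_od j k i))"
  proof
    fix ys assume "ys \<in> f ` class_ed_od n j k"
    then obtain xs where xs: "xs \<in> class_ed_od n j k" "ys = f xs" by blast
    have "n = (\<Sum>i<k + j. xs ! i)"
      using class_ed_od_D(1,2)[OF xs(1)] by (simp add: sum_list_sum_nth atLeast0LessThan)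
    also have "\<dots> = (\<Sum>i<k + j. min_ed_od j k i + 2 * (f xs ! i))"
      using nth[OF xs(1)] by simp
    also have "\<dots> = (\<Sum>i<k + j. min_ed_od j k i) + 2 * sum_list (f xs)"
      by (simp add: sum.distrib sum_distrib_left sum_list_sum_nth atLeast0LessThan len)
    finally have "int n = int (\<Sum>i<k + j. min_ed_od j k i) + 2 * int (sum_list ys)"
      unfolding xs(2) by linarith
    then have "2 * int (sum_list ys) = int n - int (\<Sum>i<k + j. min_ed_od j k i)"
      by linarith
    moreover have "sorted_wrt (\<ge>) ys"
      unfolding sorted_wrt_iff_nth_less
    proof (intro allI impI)
      fix i i' assume "i < i'" "i' < length ys"
      then show "ys ! i' \<le> ys ! i"
        using class_ed_od_ge_min(1)[OF xs(1), of i i'] nth[OF xs(1), of i] nth[OF xs(1), of i'] xs(2) len[of xs]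
        by simp
    qed
    ultimately show "ys \<in> bounded_partitions (k + j) (int n - int (\<Sum>i<k + j. min_ed_od j k i))"
      using xs len by (simp add: bounded_partitions_def)
  qed
  ultimately show ?thesis
    unfolding num_bounded_def by (simp add: card_inj_on_le finite_bounded_partitions)
qed

section \<open>Lower bound for the classes with the odd parts on top\<close>

text \<open>Even parts may repeat, so all of them are 2 in the smallest partition. The odd parts
  then end in 3, or in 1 if there are no even parts.\<close>

definition min_od_eu :: "nat \<Rightarrow> nat \<Rightarrow> nat \<Rightarrow> nat" where
  "min_od_eu j k i = (if i < j then 2 * (j - Suc i) + (if k = 0 then 1 else 3) else 2)"

lemma sum_min_od_eu:
  "(\<Sum>i<j + k. min_od_eu j k i) = j * (j - 1) + (if k = 0 then j else 3 * j) + 2 * k"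
proof -
  have "(\<Sum>i<j + t. min_od_eu j k i) = (\<Sum>i<j. min_od_eu j k i) + 2 * t" for t
    by (induction t) (auto simp: min_od_eu_def)
  moreover have "(\<Sum>i<j. min_od_eu j k i) = j * (j - 1) + (if k = 0 then j else 3 * j)"
    by (simp add: min_od_eu_def sum.distrib sum_staircase)
  ultimately show ?thesis by simp
qed

lemma card_class_od_eu_ge:
  "num_bounded (j + k) (int n - int (\<Sum>i<j + k. min_od_eu j k i)) \<le>
     int (card (class_od_eu n j k))"
proof -
  let ?Q = "bounded_partitions (j + k) (int n - int (\<Sum>i<j + k. min_od_eu j k i))"
  define f where "f = (\<lambda>xs. map (\<lambda>i. 2 * (xs ! i) + min_od_eu j k i) [0..<j + k])"
  have "inj_on f ?Q"
  proof (rule inj_onI)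
    fix xs ys assume "xs \<in> ?Q" "ys \<in> ?Q" "f xs = f ys"
    then show "xs = ys"
      by (intro nth_equalityI) (auto simp: bounded_partitions_def f_def)
  qed
  moreover have "f ` ?Q \<subseteq> class_od_eu n j k"
  proof
    fix ys assume "ys \<in> f ` ?Q"
    then obtain xs where xs: "xs \<in> ?Q" and ys: "ys = f xs" by blast
    have len: "length ys = j + k" and nth: "\<And>i. i < j + k \<Longrightarrow> ys ! i = 2 * (xs ! i) + min_od_eu j k i"
      by (simp_all add: ys f_def)
    have lenx: "length xs = j + k"
      using xs by (simp add: bounded_partitions_def)
    have mono: "xs ! i' \<le> xs ! i" if "i < i'" "i' < j + k" for i i'
      using xs that by (auto simp: bounded_partitions_def sorted_wrt_iff_nth_less)
    have odd_iff: "odd (ys ! i) \<longleftrightarrow> i < j" if "i < j + k" for i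
      using nth[OF that] by (simp add: min_od_eu_def)
    \<comment> \<open>An odd entry beats every later entry, odd or even. This gives the order, the
      position of the even parts below the odd ones, and the distinctness of the odd parts.\<close>
    have strict: "ys ! i' < ys ! i" if "i < i'" "i < j" "i' < j + k" for i i'
      using mono[OF that(1,3)] that nth[of i] nth[of i'] by (auto simp: min_od_eu_def)
    have upt: "[0..<j + k] = [0..<j] @ [j..<j + k]"
      by (rule upt_add_eq_append) simp
    let ?g = "\<lambda>i. 2 * (xs ! i) + min_od_eu j k i"
    have odd: "filter odd ys = map ?g [0..<j]" and even: "filter even ys = map ?g [j..<j + k]"
      by (auto simp: ys f_def upt filter_map o_def min_od_eu_def filter_empty_conv filter_id_conv)
    have "sorted_wrt (\<ge>) ys"
      unfolding sorted_wrt_iff_nth_less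
    proof (intro allI impI)
      fix i i' assume i: "i < i'" "i' < length ys"
      show "ys ! i' \<le> ys ! i"
      proof (cases "i < j")
        case True
        then show ?thesis
          using strict[of i i'] i len by simp
      next
        case False
        then show ?thesis
          using mono[of i i'] nth[of i] nth[of i'] i len by (simp add: min_od_eu_def)
      qed
    qed
    moreover have "\<forall>y\<in>set ys. 0 < y"
      using nth len by (auto simp: in_set_conv_nth min_od_eu_def)
    moreover have "sum_list ys = n"
    proof -
      have "sum_list ys = (\<Sum>i<j + k. 2 * (xs ! i) + min_od_eu j k i)"
        using nth by (simp add: sum_list_sum_nth len atLeast0LessThan)
      also have "\<dots> = 2 * sum_list xs + (\<Sum>i<j + k. min_od_eu j k i)"
        by (simp add: sum.distrib sum_distrib_left sum_list_sum_nth atLeast0LessThan lenx)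
      finally have "int (sum_list ys) = 2 * int (sum_list xs) + int (\<Sum>i<j + k. min_od_eu j k i)"
        by linarith
      then show ?thesis
        using xs by (simp add: bounded_partitions_def del: of_nat_sum)
    qed
    moreover have "y < x" if xy: "x \<in> set ys" "y \<in> set ys" "odd x" "even y" for x y
    proof -
      from xy obtain i i' where i: "x = ys ! i" "i < j + k" "y = ys ! i'" "i' < j + k"
        by (auto simp: in_set_conv_nth len)
      then show ?thesis
        using strict[of i i'] odd_iff[of i] odd_iff[of i'] xy by simp
    qed
    moreover have "distinct (filter odd ys)"
      unfolding odd
    proof (simp add: distinct_map, rule linorder_inj_onI')
      fix a b assume "a \<in> {0..<j}" "b \<in> {0..<j}" "a < b"
      then show "?g a \<noteq> ?g b"
        using strict[of a b] nth[of a] nth[of b] by simp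
    qed
    moreover have "length (filter odd ys) = j" "length (filter even ys) = k"
      by (simp_all add: odd even)
    ultimately show "ys \<in> class_od_eu n j k"
      by (auto simp: class_od_eu_def partitions_od_eu_def partitions_def)
  qed
  moreover have "finite (class_od_eu n j k)"
    by (simp add: class_od_eu_def finite_partitions_od_eu)
  ultimately show ?thesis
    unfolding num_bounded_def by (simp add: card_inj_on_le)
qed

section \<open>Comparison of the classes\<close>

text \<open>The subtrahends are the sums of the smallest partitions of the two classes.\<close>

definition surplus :: "nat \<Rightarrow> nat \<Rightarrow> nat \<Rightarrow> int" where
  "surplus n j k =
     num_bounded (j + k) (int n - (if k = 0 then int j ^ 2 else int j ^ 2 + 2 * int j + 2 * int k)) -
     num_bounded (j + k) (int n - (if j = 0 then int k * (int k + 1) else (int j + int k) ^ 2 - int k))"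

lemma surplus_le:
  "surplus n j k \<le> int (card (class_od_eu n j k)) - int (card (class_ed_od n j k))"
proof -
  have "int (\<Sum>i<k + j. min_ed_od j k i) =
      (if j = 0 then int k * (int k + 1) else (int j + int k) ^ 2 - int k)"
    unfolding sum_min_ed_od
    by (cases j; cases k) (auto simp: algebra_simps power2_eq_square)
  moreover have "int (\<Sum>i<j + k. min_od_eu j k i) =
      (if k = 0 then int j ^ 2 else int j ^ 2 + 2 * int j + 2 * int k)"
    unfolding sum_min_od_eu by (cases j) (auto simp: algebra_simps power2_eq_square)
  ultimately show ?thesis
    using card_class_ed_od_le[of n j k] card_class_od_eu_ge[of j k n]
    by (simp add: surplus_def add.commute del: of_nat_sum)
qed

lemma surplus_nonneg:
  assumes "j = 0 \<or> k \<noteq> 1"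
  shows "0 \<le> surplus n j k"
proof (cases "k = 0")
  case True
  then show ?thesis by (simp add: surplus_def)
next
  case k: False
  show ?thesis
  proof (cases "j = 0")
    case True
    have "2 * int k \<le> int k * (int k + 1)"
      using k by (simp add: mult.commute)
    then show ?thesis
      using k True by (simp add: surplus_def num_bounded_mono)
  next
    case False
    with assms k have "k \<ge> 2" by simp
    then obtain t where t: "k = t + 2" by (metis add.commute le_Suc_ex)
    from False obtain i where i: "j = Suc i" by (metis not0_implies_Suc)
    \<comment> \<open>After substituting \<open>j = i + 1\<close> and \<open>k = t + 2\<close>, the
      gap between the smallest sums is visibly nonnegative. It is even because \<open>t\<close> and
      \<open>t + 3\<close> have opposite parity.\<close>
    have "(int j + int k) ^ 2 - int k - (int j ^ 2 + 2 * int j + 2 * int k) =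
        2 * (int i * (int t + 1)) + int t * (int t + 3)"
      by (simp add: t i algebra_simps power2_eq_square)
    moreover have "even (2 * (int i * (int t + 1)) + int t * (int t + 3))"
      by simp
    moreover have "2 * (int i * (int t + 1)) + int t * (int t + 3) \<ge> 0"
      by simp
    ultimately have
      "num_bounded (j + k) (int n - ((int j + int k) ^ 2 - int k)) \<le>
       num_bounded (j + k) (int n - (int j ^ 2 + 2 * int j + 2 * int k))"
      using k by (intro num_bounded_mono) (simp_all add: algebra_simps)
    then show ?thesis
      using k False by (simp add: surplus_def)
  qed
qed

text \<open>A single even part is the only case with a deficit. It is made up by the partitions with
  two odd parts fewer and two even parts more, which have the same number of parts.\<close>

lemma surplus_compensation: "0 \<le> surplus n (j + 2) 1 + surplus n j 3"
proof (cases "j = 0")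
  case True
  \<comment> \<open>The smallest sums are 10 and 8 for the class \<open>(2, 1)\<close>, and 6 and 12
    for \<open>(0, 3)\<close>. The two positive terms are matched crosswise with the negative
    ones.\<close>
  define z where "z = int n - 6"
  have "num_bounded 3 (z - 6) \<le> num_bounded 3 (z - 4)" "num_bounded 3 (z - 2) \<le> num_bounded 3 z"
    by (auto intro!: num_bounded_mono)
  then show ?thesis
    using True by (simp add: surplus_def z_def numeral_eq_Suc algebra_simps)
next
  case False
  then obtain i where i: "j = Suc i" by (metis not0_implies_Suc)
  define m where "m = j + 3"
  define z where "z = int n - (int j ^ 2 + 2 * int j + 6)"
  \<comment> \<open>Here \<open>z\<close> and \<open>w + 2\<close> are the arguments of the class
    \<open>(j, 3)\<close>, and \<open>w - 2\<close> and \<open>w\<close> those of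
    \<open>(j + 2, 1)\<close>. The deficit is therefore a single step,
    \<open>num_tied m w\<close>.\<close>
  define w where "w = z - 4 * int i - 6"
  have eq: "surplus n (j + 2) 1 + surplus n j 3 =
      num_bounded m z - num_bounded m (w + 2) - (num_bounded m w - num_bounded m (w - 2))"
    by (simp add: surplus_def m_def z_def w_def i numeral_eq_Suc algebra_simps power2_eq_square)
  have m: "m \<ge> 2" by (simp add: m_def)
  have "num_bounded m (w + 2) \<le> num_bounded m (z - 4)"
    using m by (intro num_bounded_mono) (auto simp: w_def)
  moreover have "num_bounded m z = num_bounded m (z - 4) + num_tied m z + num_tied m (z - 2)"
    using num_bounded_step[OF m, of z] num_bounded_step[OF m, of "z - 2"] by simp
  moreover have "num_bounded m w - num_bounded m (w - 2) = num_tied m w"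
    using num_bounded_step[OF m, of w] by simp
  \<comment> \<open>The difference of the arguments is \<open>4 * (i + 1)\<close>.\<close>
  moreover have "num_tied m w \<le> num_tied m (z - 2)"
    using m by (intro num_tied_mono) (auto simp: w_def)
  ultimately show ?thesis
    using eq num_tied_nonneg[of m z] by linarith
qed

section \<open>Summation over all classes and strictness\<close>

text \<open>Everything left out on the left is a nonnegative class or a compensated pair. The pair
  \<open>(3, 1)\<close>, \<open>(1, 3)\<close> is kept because its surplus is needed for
  \<open>n = 9\<close> and \<open>n = 11\<close>.\<close>

lemma surplus_sum_ge:
  assumes "n \<ge> 8"
  shows "surplus n 1 1 + (surplus n 3 1 + surplus n 1 3) + surplus n 0 4 + surplus n 1 4 +
    surplus n 1 5 \<le> (\<Sum>j\<le>n. \<Sum>k\<le>n. surplus n j k)"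
proof -
  define N where "N = n - 2"
  then have N: "n = Suc (Suc N)" "1 \<le> N"
    using assms by simp_all
  have row: "surplus n j 1 + surplus n j 3 + surplus n j 4 + surplus n j 5 \<le> (\<Sum>k\<le>n. surplus n j k)" for j
  proof -
    have "(\<Sum>k\<le>n. surplus n j k) =
        (\<Sum>k\<in>{..n} - {1, 3, 4, 5}. surplus n j k) + (\<Sum>k\<in>{1, 3, 4, 5}. surplus n j k)"
      using assms by (intro sum.subset_diff) auto
    moreover have "(\<Sum>k\<in>{..n} - {1, 3, 4, 5}. surplus n j k) \<ge> 0"
      by (intro sum_nonneg surplus_nonneg) auto
    ultimately show ?thesis by simp
  qed
  have col4: "surplus n 0 4 + surplus n 1 4 \<le> (\<Sum>j\<le>n. surplus n j 4)"
  proof -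
    have "(\<Sum>j\<in>{0, 1}. surplus n j 4) \<le> (\<Sum>j\<le>n. surplus n j 4)"
      using N by (intro sum_mono2) (auto simp: surplus_nonneg)
    then show ?thesis by simp
  qed
  have col5: "surplus n 1 5 \<le> (\<Sum>j\<le>n. surplus n j 5)"
    using N by (intro member_le_sum) (auto simp: surplus_nonneg)
  have col13: "surplus n 1 1 + (surplus n 3 1 + surplus n 1 3) \<le>
      (\<Sum>j\<le>n. surplus n j 1) + (\<Sum>j\<le>n. surplus n j 3)"
  proof -
    \<comment> \<open>Shifting the row index by two aligns each deficit in column 1 with its
      compensation in column 3.\<close>
    have "(\<Sum>j\<le>n. surplus n j 1) =
        surplus n 0 1 + surplus n 1 1 + (\<Sum>j\<le>N. surplus n (j + 2) 1)"
      unfolding N(1) by (simp only: sum.atMost_Suc_shift) simp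
    moreover have "(\<Sum>j\<le>N. surplus n j 3) \<le> (\<Sum>j\<le>n. surplus n j 3)"
      using N by (intro sum_mono2) (auto simp: surplus_nonneg)
    moreover have "surplus n (1 + 2) 1 + surplus n 1 3 \<le>
        (\<Sum>j\<le>N. surplus n (j + 2) 1 + surplus n j 3)"
      using N by (intro member_le_sum[where f = "\<lambda>j. surplus n (j + 2) 1 + surplus n j 3"] surplus_compensation) auto
    ultimately show ?thesis
      using surplus_nonneg[of 0 1 n] by (simp add: sum.distrib numeral_3_eq_3[symmetric])
  qed
  have "(\<Sum>j\<le>n. surplus n j 1) + (\<Sum>j\<le>n. surplus n j 3) + (\<Sum>j\<le>n. surplus n j 4) + (\<Sum>j\<le>n. surplus n j 5)
      \<le> (\<Sum>j\<le>n. \<Sum>k\<le>n. surplus n j k)"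
    unfolding sum.distrib[symmetric] by (intro sum_mono row)
  then show ?thesis
    using col4 col5 col13 by linarith
qed

text \<open>The smallest partitions are 3 + 2 and 2 + 1, so the two arguments differ by a single
  step of 2.\<close>

lemma surplus_one_one: "surplus n 1 1 = - num_tied 2 (int n - 3)"
  using num_bounded_step[of 2 "int n - 3"] by (simp add: surplus_def numeral_2_eq_2[symmetric])

lemma surplus_sum_pos:
  assumes "n \<ge> 8"
  shows "0 < surplus n 1 1 + (surplus n 3 1 + surplus n 1 3) + surplus n 0 4 + surplus n 1 4 +
    surplus n 1 5"
proof (cases "even n")
  case True
  have "surplus n 1 1 = 0"
    unfolding surplus_one_one using True by (subst num_tied_two_eq_0) presburger+
  moreover have "surplus n 0 4 > 0"
    \<comment> \<open>The smallest sums are 8 and 20, hence the bound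
      \<open>n \<ge> 8\<close>.\<close>
    using True assms by (simp add: surplus_def num_bounded_less)
  ultimately show ?thesis
    using surplus_compensation[of n 1] surplus_nonneg[of 1 4 n] surplus_nonneg[of 1 5 n]
    by (simp add: numeral_3_eq_3[symmetric])
next
  case odd: False
  then have "n = 9 \<or> n = 11 \<or> n \<ge> 13"
    using assms odd by presburger
  then consider "n = 9" | "n = 11" | "n \<ge> 13" by blast
  then show ?thesis
  proof cases
    case 1
    have "surplus n 1 1 = 0"
      unfolding surplus_one_one 1 by (subst num_tied_two_eq_0) auto
    \<comment> \<open>The smallest sums are 9 and 13, so the arguments are 0 and -4.\<close>
    moreover have "surplus n 1 3 > 0"
      by (simp add: 1 surplus_def num_bounded_less)
    moreover have "surplus n 3 1 = 0"
      by (simp add: 1 surplus_def num_bounded_neg)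
    ultimately show ?thesis
      using surplus_nonneg[of 0 4 n] surplus_nonneg[of 1 4 n] surplus_nonneg[of 1 5 n] by simp
  next
    case 2
    have "surplus n 1 1 \<ge> -1"
      unfolding surplus_one_one using num_tied_two_le by simp
    moreover have "surplus n 1 3 > 0" "surplus n 1 4 > 0"
      by (simp_all add: 2 surplus_def num_bounded_less)
    \<comment> \<open>Both smallest sums, 17 and 15, exceed 11, so both classes are empty.\<close>
    moreover have "surplus n 3 1 = 0"
      by (simp add: 2 surplus_def num_bounded_neg)
    ultimately show ?thesis
      using surplus_nonneg[of 0 4 n] surplus_nonneg[of 1 5 n] by simp
  next
    case 3
    have "surplus n 1 1 \<ge> -1"
      unfolding surplus_one_one using num_tied_two_le by simp
    \<comment> \<open>The smaller of the smallest sums are 11 and 13, so both classes have a surplus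
      from 13 on. Two are needed to outweigh the possible -1.\<close>
    moreover have "surplus n 1 4 > 0" "surplus n 1 5 > 0"
      using 3 odd by (simp_all add: surplus_def num_bounded_less)
    ultimately show ?thesis
      using surplus_compensation[of n 1] surplus_nonneg[of 0 4 n]
      by (simp add: numeral_3_eq_3[symmetric])
  qed
qed

theorem theorem3p6:
  fixes n :: nat
  assumes "n \<ge> 8"
  shows "p_ed_od n < p_od_eu n"
proof -
  have "0 < (\<Sum>j\<le>n. \<Sum>k\<le>n. surplus n j k)"
    using surplus_sum_ge[OF assms] surplus_sum_pos[OF assms] by linarith
  also have "\<dots> \<le> (\<Sum>j\<le>n. \<Sum>k\<le>n. int (card (class_od_eu n j k)) - int (card (class_ed_od n j k)))"
    by (intro sum_mono surplus_le)
  also have "\<dots> = int (p_od_eu n) - int (p_ed_od n)"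
    by (simp add: p_od_eu_eq_sum p_ed_od_eq_sum sum_subtractf)
  finally show ?thesis by simp
qed

end
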